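(* Let $(J,R,Q,B)\in\Sigma_{n,m}$ and $S\in\mathbb{K}^{m\times m}$ with $S^H=S\ge0$ be such that $s\mathcal{E}-\mathcal{A}_S$ is regular. Choose $\mu\in\mathbb{K}\setminus\big(\sigma((J-R)Q)\cup\sigma(-((J-R)Q)^H)\big)$ such that $\mu\mathcal{E}-\mathcal{A}_S$ is invertible, and define $$E_\mu:=\begin{bmatrix}0&(J-R)Q-\mu I\\((J-R)Q)^H+\mu I&QRQ\end{bmatrix}^{-1},\qquad S_\mu:=S-\begin{bmatrix}B^H&0\end{bmatrix}E_\mu\begin{bmatrix}B\\0\end{bmatrix},$$ $$N_\mu:=\left(E_\mu+E_\mu\begin{bmatrix}B\\0\end{bmatrix}S_\mu^{-1}\begin{bmatrix}B^H&0\end{bmatrix}E_\mu\right)\begin{bmatrix}0&-I\\ I&0\end{bmatrix},\qquad M_\mu:=-S_\mu^{-1}\begin{bmatrix}B^H&0\end{bmatrix}E_\mu\begin{bmatrix}0&-I\\ I&0\end{bmatrix}.$$ A function $(\lambda,x,u)\in\mathcal{C}^1([t_0,t_1],\mathbb{K}^{n+n+m})$ is a solution of $$\frac{\mathrm{d}}{\mathrm{d}t}\mathcal{E}\begin{bmatrix}\lambda\\ x\\ u\end{bmatrix}=\mathcal{A}_S\begin{bmatrix}\lambda\\ x\\ u\end{bmatrix}$$ if and only if $\begin{bmatrix}\lambda(t_0)\\ x(t_0)\end{bmatrix}\in\operatorname{im}(N_\mu^DN_\mu)$ and, for all $t\in[t_0,t_1]$, $$\begin{bmatrix}\lambda(t)\\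 x(t)\end{bmatrix}=e^{-[N_\mu^D(I-\mu N_\mu)](t-t_0)}\begin{bmatrix}\lambda(t_0)\\ x(t_0)\end{bmatrix},\qquad u(t)=M_\mu N_\mu^D\begin{bmatrix}\lambda(t)\\ x(t)\end{bmatrix}.$$
   Context: $\mathbb{K}\in\{\mathbb{R},\mathbb{C}\}$, $n,m$ are positive integers, $t_0<t_1$ are real, $A^H$ is the conjugate transpose, $\sigma(A)$ is the set of (complex) eigenvalues of $A$, and $A\ge0$ means $x^HAx\ge0$ for all $x$. $\Sigma_{n,m}$ is the set of all $(J,R,Q,B)\in(\mathbb{K}^{n\times n})^3\times\mathbb{K}^{n\times m}$ with $J=-J^H$, $R=R^H\ge0$, $Q=Q^H\ge0$. The optimality pencil $s\mathcal{E}-\mathcal{A}_S$ has coefficients $$\mathcal{E}=\begin{bmatrix}0_{n\times n}&I_n&0_{n\times m}\\-I_n&0_{n\times n}&0_{n\times m}\\0_{m\times n}&0_{m\times n}&0_{m\times m}\end{bmatrix},\qquad \mathcal{A}_S=\begin{bmatrix}0_{n\times n}&(J-R)Q&B\\((J-R)Q)^H&QRQ&0_{n\times m}\\ B^H&0_{m\times n}&S\end{bmatrix}.$$ It is called regular if $\det(s\mathcal{E}-\mathcal{A}_S)$ is not the zero polynomial in $s$. The Drazin inverse $M^D$ of a square matrix $M$ is the unique matrix with $M^DM=MM^D$, $M^DMM^D=M^D$ and $M^DM^{\nu+1}=M^\nu$ for some $\nu\in\mathbb{N}_0$. *)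

theory Defs
  imports
    "HOL-Analysis.Analysis"
    "HOL-Computational_Algebra.Polynomial"
begin

text \<open>
  The ground field is a set \<open>K\<close> of complex numbers, either \<open>\<real>\<close> or \<open>UNIV\<close>. Vectors and
  matrices over \<open>K\<close> are complex vectors and matrices all of whose entries lie in \<open>K\<close>;
  for \<open>K = \<real>\<close> the conjugate transpose is the transpose.
\<close>

definition vecs :: "complex set \<Rightarrow> (complex^'n) set" where
  "vecs K = {v. \<forall>i. v $ i \<in> K}"

definition mats :: "complex set \<Rightarrow> (complex^'n^'m) set" where
  "mats K = {A. \<forall>i j. A $ i $ j \<in> K}"

definition ctranspose :: "complex^'n^'m \<Rightarrow> complex^'m^'n"  (\<open>_\<^sup>H\<close> [1000] 1000) where
  "A\<^sup>H = transpose (map_matrix cnj A)"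

text \<open>Membership in \<open>\<real>\<^sub>\<ge>\<^sub>0\<close> says that the complex number \<open>x\<^sup>H A x\<close> is real and nonnegative.\<close>

definition pos_semidef :: "complex set \<Rightarrow> complex^'n^'n \<Rightarrow> bool" where
  "pos_semidef K A \<longleftrightarrow> (\<forall>x\<in>vecs K. (\<Sum>i\<in>UNIV. cnj (x $ i) * (A *v x) $ i) \<in> \<real>\<^sub>\<ge>\<^sub>0)"

definition spectrum :: "complex^'n^'n \<Rightarrow> complex set" where
  "spectrum A = {z. \<exists>v. v \<noteq> 0 \<and> A *v v = z *s v}"

definition Sigma_sys ::
  "complex set \<Rightarrow>
     ((complex^'n^'n) \<times> (complex^'n^'n) \<times> (complex^'n^'n) \<times> (complex^'m^'n)) set" where
  "Sigma_sys K = {(J, R, Q, B).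
     J \<in> mats K \<and> R \<in> mats K \<and> Q \<in> mats K \<and> B \<in> mats K \<and>
     J = - J\<^sup>H \<and> R = R\<^sup>H \<and> pos_semidef K R \<and> Q = Q\<^sup>H \<and> pos_semidef K Q}"

text \<open>
  Block vectors and matrices are indexed by sum types. A matrix is a vector of rows, so
  \<open>vcat\<close> also puts one matrix on top of another.
\<close>

definition vcat :: "'a^'n \<Rightarrow> 'a^'m \<Rightarrow> 'a^('n + 'm)" where
  "vcat v w = (\<chi> i. case i of Inl j \<Rightarrow> v $ j | Inr j \<Rightarrow> w $ j)"

definition hcat :: "'a^'n^'p \<Rightarrow> 'a^'m^'p \<Rightarrow> 'a^('n + 'm)^'p" where
  "hcat A B = (\<chi> i. vcat (A $ i) (B $ i))"

definition block :: "'a^'n^'p \<Rightarrow> 'a^'m^'p \<Rightarrow> 'a^'n^'q \<Rightarrow> 'a^'m^'q \<Rightarrow> 'a^('n + 'm)^('p + 'q)" where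
  "block A B C D = vcat (hcat A B) (hcat C D)"

definition pencil_E :: "complex^(('n::finite + 'n) + 'm::finite)^(('n + 'n) + 'm)" where
  "pencil_E = block (block 0 (mat 1) (- mat 1) 0) 0 0 0"

definition pencil_A ::
  "complex^'n::finite^'n \<Rightarrow> complex^'n^'n \<Rightarrow> complex^'n^'n \<Rightarrow> complex^'m::finite^'n \<Rightarrow> complex^'m^'m
   \<Rightarrow> complex^(('n + 'n) + 'm)^(('n + 'n) + 'm)" where
  "pencil_A J R Q B S =
     block (block 0 ((J - R) ** Q) ((J - R) ** Q)\<^sup>H (Q ** R ** Q)) (vcat B 0)
           (hcat (B\<^sup>H) 0) S"

text \<open>The polynomial in the variable \<open>s\<close> is \<open>det (s E - A)\<close>.\<close>

definition regular_pencil :: "complex^'n^'n \<Rightarrow> complex^'n^'n \<Rightarrow> bool" where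
  "regular_pencil E A \<longleftrightarrow> det (\<chi> i j. [:- (A $ i $ j), E $ i $ j:]) \<noteq> 0"

text \<open>
  The operations \<open>*\<close>, \<open>1\<close>, \<open>^\<close> of the library on type \<open>_^_\<close> are componentwise, so
  powers and the exponential with respect to \<open>**\<close> are introduced separately.
\<close>

primrec matpow :: "complex^'n^'n \<Rightarrow> nat \<Rightarrow> complex^'n^'n" where
  "matpow A 0 = mat 1"
| "matpow A (Suc k) = A ** matpow A k"

definition matexp :: "complex^'n^'n \<Rightarrow> complex^'n^'n" where
  "matexp A = (\<Sum>k. matpow A k /\<^sub>R fact k)"

definition is_drazin_inverse :: "complex^'n^'n \<Rightarrow> complex^'n^'n \<Rightarrow> bool" where
  "is_drazin_inverse M D \<longleftrightarrow>
     D ** M = M ** D \<and> D ** M ** D = D \<and> (\<exists>\<nu>. D ** matpow M (\<nu> + 1) = matpow M \<nu>)"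

definition drazin_inverse :: "complex^'n^'n \<Rightarrow> complex^'n^'n"  (\<open>_\<^sup>D\<close> [1000] 1000) where
  "M\<^sup>D = (THE D. is_drazin_inverse M D)"

text \<open>
  Functions on \<open>{a..b}\<close> are total functions of which only the values on \<open>{a..b}\<close> matter;
  derivatives at the end points are one-sided. This differs from the library's
  \<open>C1_differentiable_on\<close>, which uses two-sided derivatives.
\<close>

definition C1_fun :: "complex set \<Rightarrow> real \<Rightarrow> real \<Rightarrow> (real \<Rightarrow> complex^'n) \<Rightarrow> bool" where
  "C1_fun K a b z \<longleftrightarrow>
     (\<forall>t\<in>{a..b}. z t \<in> vecs K) \<and>
     (\<exists>z'. (\<forall>t\<in>{a..b}. (z has_vector_derivative z' t) (at t within {a..b})) \<and>
           continuous_on {a..b} z')"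

definition dae_solution ::
  "real \<Rightarrow> real \<Rightarrow> complex^'n^'n \<Rightarrow> complex^'n^'n \<Rightarrow> (real \<Rightarrow> complex^'n) \<Rightarrow> bool" where
  "dae_solution a b E A z \<longleftrightarrow>
     (\<forall>t\<in>{a..b}. ((\<lambda>t. E *v z t) has_vector_derivative A *v z t) (at t within {a..b}))"

end

theory Submission
  imports Defs
begin

text \<open>
  Write \<open>w = (\<lambda>, x)\<close>. Subtracting \<open>\<mu> \<E> z\<close> from both sides of \<open>\<E> z' = \<A> z\<close> expresses the
  differential-algebraic equation through \<open>d = w' - \<mu>w\<close> on the left and the invertible matrix
  \<open>\<A> - \<mu>\<E>\<close> on the right. At each time this is a linear system for \<open>(w, u)\<close> in terms of \<open>d\<close>, and
  elimination with the Schur complement \<open>S\<^sub>\<mu>\<close> (lemma \<open>schur_complement_solve\<close>) turns it into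
  \<open>w = -N\<^sub>\<mu> d\<close> and \<open>u = -M\<^sub>\<mu> d\<close>.

  The first of these is the equation \<open>N\<^sub>\<mu> w' = -(I - \<mu>N\<^sub>\<mu>) w\<close>. The Drazin inverse splits it into a
  nilpotent part, where only the zero solution survives, and the range of \<open>N\<^sub>\<mu>\<^sup>D N\<^sub>\<mu>\<close>, where it becomes
  the ordinary differential equation \<open>w' = -N\<^sub>\<mu>\<^sup>D (I - \<mu>N\<^sub>\<mu>) w\<close> (lemma \<open>shifted_dae_solution_iff\<close>).
  Its solutions are given by the matrix exponential and stay in that range if they start there
  (lemma \<open>projected_ode_solution_iff\<close>). For such \<open>w\<close> one has \<open>d = -N\<^sub>\<mu>\<^sup>D w\<close>, which gives the formula
  for \<open>u\<close>.
\<close>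

section \<open>Linearity of matrix products and powers of matrices\<close>

lemma matpow_commute:
  assumes "A ** C = C ** A"
  shows "matpow A k ** C = C ** matpow A k"
proof (induction k)
  case (Suc k)
  have "matpow A (Suc k) ** C = A ** (matpow A k ** C)"
    by (simp add: matrix_mul_assoc)
  also have "\<dots> = (A ** C) ** matpow A k"
    by (simp add: Suc matrix_mul_assoc)
  also have "\<dots> = C ** matpow A (Suc k)"
    by (simp add: assms matrix_mul_assoc)
  finally show ?case .
qed simp

lemma matpow_add: "matpow A (i + j) = matpow A i ** matpow A j"
  by (induction i) (simp_all add: matrix_mul_assoc)

lemma matpow_Suc_right: "matpow A (Suc k) = matpow A k ** A"
  using matpow_commute[of A A k] by simp

lemma linear_matrix_mult_left: "linear (\<lambda>X. (A :: complex^'n^'m) ** (X :: complex^'p^'n))"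
  by (rule linearI)
     (simp_all add: vec_eq_iff matrix_matrix_mult_def sum.distrib scaleR_sum_right algebra_simps)

lemma linear_mult_vector: "linear (\<lambda>X. (X :: complex^'n^'m) *v v)"
  by (rule linearI)
     (simp_all add: vec_eq_iff matrix_vector_mult_def sum.distrib scaleR_sum_right algebra_simps)

lemma linear_matrix_mult_right: "linear (\<lambda>X. (X :: complex^'n^'m) ** (A :: complex^'p^'n))"
  by (rule linearI)
     (simp_all add: vec_eq_iff matrix_matrix_mult_def sum.distrib scaleR_sum_right algebra_simps)

lemma matpow_scaleR: "matpow (c *\<^sub>R A) k = c ^ k *\<^sub>R matpow A k"
  by (induction k)
     (simp_all add: linear_scale[OF linear_matrix_mult_left] linear_scale[OF linear_matrix_mult_right])

lemma matrix_mult_minus: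
  fixes A :: "complex^'n^'m" and C :: "complex^'p^'n" and v :: "complex^'n"
  shows "A ** (- C) = - (A ** C)" "(- A) ** C = - (A ** C)"
    "A *v (- v) = - (A *v v)" "(- A) *v v = - (A *v v)"
  by (simp_all add: vec_eq_iff matrix_matrix_mult_def matrix_vector_mult_def sum_negf)

lemma linear_matrix_vector_smult: "(A :: complex^'n^'m) *v (c *s v) = c *s (A *v v)"
  by (simp add: vec_eq_iff matrix_vector_mult_def sum_distrib_left mult_ac)

lemma mat_smult: "mat c *v v = c *s (v :: complex^'n)"
  by (simp add: vec_eq_iff matrix_vector_mult_def mat_def if_distrib if_distribR cong: if_cong)

section \<open>The Drazin inverse\<close>

text \<open>
The spans of the tails \<open>A\<^sup>k, A\<^sup>k\<^sup>+\<^sup>1, \<dots>\<close> form a decreasing sequence of finite-dimensional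
spaces. Once the dimension is minimal, \<open>A\<^sup>k\<close> is a combination of higher powers of \<open>A\<close>, hence
\<open>A\<^sup>k\<^sup>+\<^sup>1\<close> times a polynomial in \<open>A\<close>. Of that polynomial only the commutation with \<open>A\<close> is
recorded.
\<close>

lemma power_factor_exists:
  fixes A :: "complex^'n^'n"
  obtains k C where "A ** C = C ** A" "matpow A k = matpow A (Suc k) ** C"
proof -
  define U where "U = (\<lambda>k. span {matpow A j |j. k \<le> j})"
  have mono: "U (Suc k) \<subseteq> U k" for k
    unfolding U_def by (rule span_mono) (auto dest: Suc_leD)
  obtain k where k: "\<And>y. dim (U k) \<le> dim (U y)"
    using arg_min_nat_lemma[of "\<lambda>_. True" _ "\<lambda>k. dim (U k)"] by auto
  have "U (Suc k) = U k"
    by (rule subspace_dim_equal[OF _ _ mono k]) (simp_all add: U_def)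
  then have *: "matpow A k \<in> span {matpow A j |j. Suc k \<le> j}"
    by (auto simp: U_def intro: span_base)
  let ?W = "{matpow A (Suc k) ** C |C. A ** C = C ** A}"
  note lr = linear_matrix_mult_right[of A]
  have "subspace ?W"
  proof (rule subspaceI)
    show "0 \<in> ?W"
      by (auto intro!: exI[of _ 0] simp: vec_eq_iff matrix_matrix_mult_def)
  next
    fix x y assume "x \<in> ?W" "y \<in> ?W"
    then obtain C D where "x = matpow A (Suc k) ** C" "y = matpow A (Suc k) ** D"
      "A ** C = C ** A" "A ** D = D ** A" by blast
    then show "x + y \<in> ?W"
      by (intro CollectI exI[of _ "C + D"])
         (simp add: linear_add[OF lr] matrix_add_ldistrib del: matpow.simps)
  next
    fix c :: real and x assume "x \<in> ?W"
    then obtain C where "x = matpow A (Suc k) ** C" "A ** C = C ** A" by blast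
    then show "c *\<^sub>R x \<in> ?W"
      by (intro CollectI exI[of _ "c *\<^sub>R C"])
         (simp add: linear_scale[OF lr] linear_scale[OF linear_matrix_mult_left] del: matpow.simps)
  qed
  moreover have "{matpow A j |j. Suc k \<le> j} \<subseteq> ?W"
  proof safe
    fix j assume "Suc k \<le> j"
    then show "\<exists>C. matpow A j = matpow A (Suc k) ** C \<and> A ** C = C ** A"
      using matpow_add[of A "Suc k" "j - Suc k"] matpow_commute[of A A "j - Suc k"]
      by (intro exI[of _ "matpow A (j - Suc k)"]) (simp del: matpow.simps)
  qed
  ultimately have "span {matpow A j |j. Suc k \<le> j} \<subseteq> ?W"
    by (rule span_minimal[rotated])
  with * that show ?thesis by blast
qed

text \<open>
If \<open>A\<^sup>k = A\<^sup>k\<^sup>+\<^sup>1 C\<close> with \<open>C\<close> commuting with \<open>A\<close>, then \<open>A\<^sup>k\<close> absorbs every factor \<open>A\<^sup>i C\<^sup>i\<close>,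
and \<open>A\<^sup>k C\<^sup>k\<^sup>+\<^sup>1\<close> is the Drazin inverse: the exponent of \<open>C\<close> exceeds that of \<open>A\<close> by one because
\<open>C\<close> inverts \<open>A\<close> on the range of \<open>A\<^sup>k\<close>.
\<close>

lemma is_drazin_inverse_exists: "\<exists>D. is_drazin_inverse A D"
proof -
  obtain k C where comm: "A ** C = C ** A" and k: "matpow A k = matpow A (Suc k) ** C"
    by (rule power_factor_exists)
  have AC: "matpow A i ** matpow C j = matpow C j ** matpow A i" for i j
    using matpow_commute[OF matpow_commute[OF comm[symmetric], of j, symmetric], of i] .
  have absorb: "matpow A (k + i) ** matpow C i = matpow A k" for i
  proof (induction i)
    case (Suc i)
    have "matpow A (k + Suc i) ** matpow C (Suc i) = matpow A i ** (matpow A (Suc k) ** C) ** matpow C i"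
      using matpow_add[of A i "Suc k"] by (simp add: matrix_mul_assoc add.commute del: matpow.simps(2))
         (simp add: matrix_mul_assoc)
    also have "\<dots> = matpow A (k + i) ** matpow C i"
      by (simp add: k[symmetric] matpow_add[symmetric] add.commute del: matpow.simps)
    finally show ?case using Suc by simp
  qed simp
  define D where "D = matpow A k ** matpow C (Suc k)"
  have "D ** A = A ** D"
    unfolding D_def using matpow_commute[OF comm[symmetric], of "Suc k"] matpow_commute[of A A k]
    by (metis matrix_mul_assoc)
  moreover have DA: "D ** matpow A (Suc k) = matpow A k"
  proof -
    have "D ** matpow A (Suc k) = matpow A k ** (matpow A (Suc k) ** matpow C (Suc k))"
      unfolding D_def matrix_mul_assoc[symmetric] AC[of "Suc k" "Suc k"] ..
    also have "\<dots> = matpow A k"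
      using absorb[of "Suc k"] unfolding matpow_add matrix_mul_assoc .
    finally show ?thesis .
  qed
  moreover have "D ** A ** D = D"
  proof -
    have "D ** A ** D = (D ** matpow A (Suc k)) ** matpow C (Suc k)"
      unfolding D_def by (simp add: matrix_mul_assoc)
    then show ?thesis unfolding DA by (simp only: D_def)
  qed
  ultimately show ?thesis
    unfolding is_drazin_inverse_def by (intro exI[of _ D] conjI exI[of _ k]) simp_all
qed

lemma is_drazin_inverse_power_left:
  assumes D: "is_drazin_inverse A D"
  shows "matpow A k ** matpow D (Suc k) = D" "matpow D (Suc k) ** matpow A k = D"
proof -
  have c: "D ** A = A ** D" and d: "D ** A ** D = D"
    using D by (auto simp: is_drazin_inverse_def)
  show *: "matpow A i ** matpow D (Suc i) = D" for i
  proof (induction i)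
    case (Suc i)
    have "matpow A (Suc i) ** matpow D (Suc (Suc i)) = A ** (matpow A i ** matpow D (Suc i)) ** D"
      by (simp add: matpow_Suc_right[of D "Suc i"] matrix_mul_assoc del: matpow.simps(2))
         (simp add: matrix_mul_assoc)
    also have "\<dots> = D" using d unfolding Suc c .
    finally show ?case .
  qed simp
  show "matpow D (Suc k) ** matpow A k = D"
    using *[of k] matpow_commute[OF matpow_commute[OF c, of "Suc k", symmetric], of k] by metis
qed

text \<open>
Both inverses are brought to the form \<open>D A D'\<close>: a high power of \<open>A\<close> is split off one of them, and
on that power the other one acts as an inverse of \<open>A\<close>.
\<close>

lemma is_drazin_inverse_unique:
  assumes D: "is_drazin_inverse A D" and D': "is_drazin_inverse A D'"
  shows "D = D'"
proof -
  have c': "D' ** A = A ** D'"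
    using D' by (auto simp: is_drazin_inverse_def)
  obtain k where k: "D ** matpow A (Suc k) = matpow A k"
    using D by (auto simp: is_drazin_inverse_def)
  obtain k' where k': "D' ** matpow A (Suc k') = matpow A k'"
    using D' by (auto simp: is_drazin_inverse_def)
  have "D = matpow D (Suc k') ** (D' ** matpow A (Suc k'))"
    by (simp add: is_drazin_inverse_power_left(2)[OF D] k' del: matpow.simps)
  also have "\<dots> = matpow D (Suc k') ** (matpow A (Suc k') ** D')"
    unfolding matpow_commute[OF c'[symmetric]] ..
  also have "\<dots> = matpow D (Suc k') ** matpow A k' ** A ** D'"
    by (simp add: matpow_Suc_right[of A] matrix_mul_assoc del: matpow.simps)
  also have "\<dots> = D ** A ** (matpow A k ** matpow D' (Suc k))"
    by (simp add: is_drazin_inverse_power_left[OF D] is_drazin_inverse_power_left[OF D']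
        del: matpow.simps)
  also have "\<dots> = D ** matpow A (Suc k) ** matpow D' (Suc k)"
    by (simp add: matrix_mul_assoc)
  also have "\<dots> = D'"
    by (simp add: k is_drazin_inverse_power_left[OF D'] del: matpow.simps)
  finally show ?thesis .
qed

lemma is_drazin_inverse_drazin_inverse: "is_drazin_inverse A (A\<^sup>D)"
proof -
  obtain D where "is_drazin_inverse A D" using is_drazin_inverse_exists by blast
  then show ?thesis
    unfolding drazin_inverse_def by (rule theI) (rule is_drazin_inverse_unique[OF _ \<open>is_drazin_inverse A D\<close>])
qed

lemma drazin_inverse_commute: "A\<^sup>D ** A = A ** A\<^sup>D"
  and drazin_inverse_sandwich: "A\<^sup>D ** A ** A\<^sup>D = A\<^sup>D"
  using is_drazin_inverse_drazin_inverse[of A] by (auto simp: is_drazin_inverse_def)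

section \<open>The matrix exponential and linear differential equations\<close>

lemma matpow_norm_bound:
  fixes A :: "complex^'n^'n"
  obtains b where "0 < b" "\<And>k. norm (matpow A k) \<le> b ^ k * norm (mat 1 :: complex^'n^'n)"
proof -
  obtain b where b: "b > 0" "\<And>X :: complex^'n^'n. norm (A ** X) \<le> b * norm X"
    using linear_bounded_pos[OF linear_matrix_mult_left, of A] by auto
  have "norm (matpow A k) \<le> b ^ k * norm (mat 1 :: complex^'n^'n)" for k
  proof (induction k)
    case (Suc k)
    have "norm (matpow A (Suc k)) \<le> b * norm (matpow A k)" using b(2) by simp
    also have "\<dots> \<le> b * (b ^ k * norm (mat 1 :: complex^'n^'n))"
      using Suc b(1) by (intro mult_left_mono) auto
    finally show ?case by (simp add: mult.assoc)
  qed simp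
  with b(1) that show ?thesis by blast
qed

lemma summable_matexp:
  fixes A :: "complex^'n^'n"
  shows "summable (\<lambda>k. matpow A k /\<^sub>R fact k)"
proof -
  obtain b where b: "0 < b" "\<And>k. norm (matpow A k) \<le> b ^ k * norm (mat 1 :: complex^'n^'n)"
    using matpow_norm_bound[of A] by blast
  show ?thesis
  proof (rule summable_comparison_test')
    show "summable (\<lambda>k. inverse (fact k) * b ^ k * norm (mat 1 :: complex^'n^'n))"
      by (intro summable_mult2 summable_exp)
    show "norm (matpow A k /\<^sub>R fact k) \<le> inverse (fact k) * b ^ k * norm (mat 1 :: complex^'n^'n)" for k
      using b(2)[of k] by (simp add: mult.assoc mult_left_mono)
  qed
qed

lemma matexp_0 [simp]: "matexp 0 = mat 1"
proof -
  have "matpow 0 k /\<^sub>R fact k = (0 :: complex^'n^'n)" if "k \<notin> {0}" for k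
    using that by (cases k) simp_all
  then have "matexp (0 :: complex^'n^'n) = (\<Sum>k\<in>{0}. matpow 0 k /\<^sub>R fact k)"
    unfolding matexp_def by (intro suminf_finite) auto
  then show ?thesis by simp
qed

text \<open>
Every real coordinate of \<open>matexp (t A)\<close> is an everywhere convergent scalar power series in \<open>t\<close>,
which may be differentiated termwise; the derived series is the corresponding coordinate of
\<open>A ** matexp (t A)\<close>.
\<close>

lemma has_vector_derivative_matexp:
  "((\<lambda>t. matexp (t *\<^sub>R A)) has_vector_derivative A ** matexp (s *\<^sub>R A)) (at s within T)"
proof -
  have ser: "matexp (t *\<^sub>R A) \<bullet> i = (\<Sum>k. (matpow A k \<bullet> i) / fact k * t ^ k)" for t i
    using bounded_linear.suminf[OF bounded_linear_inner_left[of i] summable_matexp, of "t *\<^sub>R A"]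
    by (simp add: matexp_def matpow_scaleR inner_scaleR_left divide_inverse mult_ac)
  have summ: "summable (\<lambda>k. (matpow A k \<bullet> i) / fact k * t ^ k)" for t i
    using bounded_linear.summable[OF bounded_linear_inner_left[of i] summable_matexp, of "t *\<^sub>R A"]
    by (simp add: matpow_scaleR divide_inverse mult_ac)
  have left: "bounded_linear (\<lambda>X. A ** X)"
    using linear_conv_bounded_linear linear_matrix_mult_left by blast
  have "(A ** matexp (s *\<^sub>R A)) \<bullet> i = (\<Sum>k. (A ** (matpow (s *\<^sub>R A) k /\<^sub>R fact k)) \<bullet> i)" for i
    unfolding matexp_def bounded_linear.suminf[OF left summable_matexp]
    using bounded_linear.suminf[OF bounded_linear_inner_left bounded_linear.summable[OF left summable_matexp]] .
  moreover have "diffs (\<lambda>k. (matpow A k \<bullet> i) / fact k) k * s ^ k = (A ** (matpow (s *\<^sub>R A) k /\<^sub>R fact k)) \<bullet> i" for i k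
    by (simp add: diffs_def matpow_scaleR linear_scale[OF linear_matrix_mult_left] field_simps del: of_nat_Suc)
  ultimately have "((\<lambda>t. matexp (t *\<^sub>R A) \<bullet> i) has_field_derivative ((A ** matexp (s *\<^sub>R A)) \<bullet> i)) (at s)" for i
    using termdiffs_strong_converges_everywhere[OF summ, of i s] by (simp add: ser)
  then show ?thesis
    unfolding has_vector_derivative_def has_derivative_componentwise_within[of "\<lambda>t. matexp (t *\<^sub>R A)"]
    by (auto simp: has_field_derivative_def mult_commute_abs intro: has_derivative_at_withinI)
qed

text \<open>
Gronwall's argument: \<open>\<parallel>y\<parallel>\<^sup>2\<close> grows at a rate of at most \<open>2c\<parallel>y\<parallel>\<^sup>2\<close>, where \<open>c\<close> bounds the operator
norm of \<open>G\<close>, so \<open>exp (-2ct) \<parallel>y t\<parallel>\<^sup>2\<close> is nonincreasing. It starts at zero and is nonnegative.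
\<close>

lemma linear_ode_unique_zero:
  fixes y :: "real \<Rightarrow> complex^'n"
  assumes y: "\<And>t. t \<in> {a..b} \<Longrightarrow> (y has_vector_derivative G *v y t) (at t within {a..b})"
    and "y a = 0" and t: "t \<in> {a..b}"
  shows "y t = 0"
proof -
  obtain c where c: "c > 0" "\<And>v. norm (G *v v) \<le> c * norm v"
    using linear_bounded_pos[OF matrix_vector_mul_linear, of G] by auto
  define \<phi> where "\<phi> = (\<lambda>t. exp (- 2 * c * t) * (y t \<bullet> y t))"
  have d: "(\<phi> has_real_derivative exp (- 2 * c * s) * (2 * (y s \<bullet> (G *v y s)) - 2 * c * (y s \<bullet> y s)))
          (at s within {a..b})" if "s \<in> {a..b}" for s
    unfolding \<phi>_def has_field_derivative_def
    using y[OF that, unfolded has_vector_derivative_def]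
    by (auto intro!: derivative_eq_intros simp: algebra_simps inner_commute)
  have le: "exp (- 2 * c * s) * (2 * (y s \<bullet> (G *v y s)) - 2 * c * (y s \<bullet> y s)) \<le> 0" for s
  proof -
    have "y s \<bullet> (G *v y s) \<le> norm (y s) * norm (G *v y s)"
      by (rule norm_cauchy_schwarz)
    also have "\<dots> \<le> norm (y s) * (c * norm (y s))"
      by (intro mult_left_mono c) simp
    finally show ?thesis
      by (intro mult_nonneg_nonpos) (auto simp: dot_square_norm power2_eq_square mult_ac)
  qed
  have "\<phi> t \<le> \<phi> a"
  proof (rule DERIV_nonpos_imp_decreasing_open[of a t \<phi>])
    show "a \<le> t" using t by simp
    fix s assume "a < s" "s < t"
    then have "s \<in> interior {a..b}" "s \<in> {a..b}" using t by auto
    then show "\<exists>y. (\<phi> has_real_derivative y) (at s) \<and> y \<le> 0"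
      using d[of s] le[of s] at_within_interior[of s "{a..b}"] by auto
  next
    show "continuous_on {a..t} \<phi>"
      using t by (intro continuous_on_subset[OF DERIV_continuous_on[OF d]]) auto
  qed
  then have "y t \<bullet> y t \<le> 0"
    using \<open>y a = 0\<close> by (simp add: \<phi>_def mult_le_0_iff)
  then show ?thesis using inner_gt_zero_iff[of "y t"] by linarith
qed

text \<open>
Initial values determine the solutions of a linear ODE. The range of \<open>P\<close> is invariant because
\<open>P ** G = G\<close> makes \<open>w - P w\<close> constant, so membership in it need only be required at time \<open>a\<close>.
\<close>

lemma projected_ode_solution_iff:
  fixes w :: "real \<Rightarrow> complex^'n" and N :: "complex^'n^'n"
  assumes "a < b"
    and w: "\<And>t. t \<in> {a..b} \<Longrightarrow> (w has_vector_derivative w' t) (at t within {a..b})"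
    and PG: "P ** G = G"
  shows "(\<forall>t\<in>{a..b}. w t = P *v w t \<and> w' t = - (G *v w t)) \<longleftrightarrow>
    w a = P *v w a \<and> (\<forall>t\<in>{a..b}. w t = matexp (- ((t - a) *\<^sub>R G)) *v w a)"
proof -
  define e where "e = (\<lambda>t. matexp (- ((t - a) *\<^sub>R G)) *v w a)"
  have e: "(e has_vector_derivative - (G *v e t)) (at t within T)" for t T
  proof -
    have "((\<lambda>t. matexp ((t - a) *\<^sub>R (- G))) has_vector_derivative
        (1 - 0) *\<^sub>R ((- G) ** matexp ((t - a) *\<^sub>R (- G)))) (at t within T)"
      by (rule vector_diff_chain_within[of "\<lambda>t. t - a", unfolded o_def, OF _ has_vector_derivative_matexp])
         (rule has_vector_derivative_diff has_vector_derivative_id has_vector_derivative_const)+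
    from bounded_linear.has_vector_derivative[OF linear_conv_bounded_linear[THEN iffD1, OF linear_mult_vector] this]
    show ?thesis by (simp add: e_def matrix_mult_minus matrix_vector_mul_assoc)
  qed
  have ea: "e a = w a" by (simp add: e_def)
  show ?thesis
  proof
    assume *: "\<forall>t\<in>{a..b}. w t = P *v w t \<and> w' t = - (G *v w t)"
    have "w t - e t = 0" if t: "t \<in> {a..b}" for t
    proof (rule linear_ode_unique_zero[of a b "\<lambda>t. w t - e t" "- G"])
      fix s assume s: "s \<in> {a..b}"
      have "w' s = - (G *v w s)" using * s by blast
      then have "w' s - - (G *v e s) = (- G) *v (w s - e s)"
        by (simp add: matrix_mult_minus matrix_vector_mult_diff_distrib)
      then show "((\<lambda>t. w t - e t) has_vector_derivative (- G) *v (w s - e s)) (at s within {a..b})"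
        using has_vector_derivative_diff[OF w[OF s] e[of s "{a..b}"]] by simp
    qed (use t ea in auto)
    then have "\<forall>t\<in>{a..b}. w t = matexp (- ((t - a) *\<^sub>R G)) *v w a"
      unfolding right_minus_eq e_def by blast
    moreover have "w a = P *v w a"
      using * \<open>a < b\<close> by (meson atLeastAtMost_iff less_imp_le order_refl)
    ultimately show "w a = P *v w a \<and> (\<forall>t\<in>{a..b}. w t = matexp (- ((t - a) *\<^sub>R G)) *v w a)"
      by blast
  next
    assume *: "w a = P *v w a \<and> (\<forall>t\<in>{a..b}. w t = matexp (- ((t - a) *\<^sub>R G)) *v w a)"
    then have we: "w t = e t" if "t \<in> {a..b}" for t using that unfolding e_def by blast
    have w': "w' t = - (G *v w t)" if t: "t \<in> {a..b}" for t
    proof -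
      have "(e has_vector_derivative w' t) (at t within {a..b})"
        by (rule has_vector_derivative_transform[OF t we[symmetric] w[OF t]])
      then show ?thesis
        using vector_derivative_unique_within_closed_interval[OF \<open>a < b\<close>, of t e] t e[of t "{a..b}"] we[OF t]
        by (metis box_real(2))
    qed
    have "w t - P *v w t = w a - P *v w a" if t: "t \<in> {a..b}" for t
    proof -
      have "((\<lambda>t. w t - P *v w t) has_vector_derivative 0) (at s within {a..b})" if s: "s \<in> {a..b}" for s
      proof -
        have "((\<lambda>t. w t - P *v w t) has_vector_derivative w' s - P *v w' s) (at s within {a..b})"
          by (intro bounded_linear.has_vector_derivative[OF matrix_vector_mul_bounded_linear]
              has_vector_derivative_diff w s)
        then show ?thesis by (simp add: w'[OF s] matrix_mult_minus matrix_vector_mul_assoc PG)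
      qed
      then obtain c where "\<And>s. s \<in> {a..b} \<Longrightarrow> w s - P *v w s = c"
        by (rule has_vector_derivative_zero_constant[of "{a..b}", rotated]) auto
      then show ?thesis using t \<open>a < b\<close> by simp
    qed
    moreover have "w a - P *v w a = 0"
      unfolding right_minus_eq using * by blast
    ultimately have "w t - P *v w t = 0" if "t \<in> {a..b}" for t
      using that by metis
    then show "\<forall>t\<in>{a..b}. w t = P *v w t \<and> w' t = - (G *v w t)"
      unfolding right_minus_eq using w' by blast
  qed
qed

section \<open>The equation with a singular leading matrix\<close>

text \<open>
The equation reads \<open>N w' = -(I - \<mu>N) w\<close>. On the kernel of the projection \<open>N\<^sup>D N\<close> the matrix
\<open>N\<close> is nilpotent, and there a solution \<open>y\<close> must vanish: if \<open>N\<^sup>i\<^sup>+\<^sup>1 y\<close> vanishes on the whole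
interval then so does its derivative, and multiplying the equation by \<open>N\<^sup>i\<close> leaves \<open>N\<^sup>i y = 0\<close>.
This descent on the exponent uses only the first derivative of \<open>w\<close>. On the range of the
projection \<open>N\<^sup>D\<close> inverts \<open>N\<close>, and the equation becomes an explicit one.
\<close>

lemma shifted_dae_solution_iff:
  fixes N :: "complex^'n^'n" and w :: "real \<Rightarrow> complex^'n" and \<mu> :: complex
  assumes "a < b"
    and w: "\<And>t. t \<in> {a..b} \<Longrightarrow> (w has_vector_derivative w' t) (at t within {a..b})"
  defines "G \<equiv> N\<^sup>D ** (mat 1 - mat \<mu> ** N)"
  shows "(\<forall>t\<in>{a..b}. w t = - (N *v (w' t - \<mu> *s w t))) \<longleftrightarrow>
    (\<forall>t\<in>{a..b}. w t = (N\<^sup>D ** N) *v w t \<and> w' t = - (G *v w t))"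
proof -
  note c = drazin_inverse_commute[of N] and d = drazin_inverse_sandwich[of N]
  obtain k where k: "N\<^sup>D ** matpow N (Suc k) = matpow N k"
    using is_drazin_inverse_drazin_inverse[of N] by (auto simp: is_drazin_inverse_def)
  note lin = matrix_vector_mult_diff_distrib matrix_vector_right_distrib
    linear_matrix_vector_smult matrix_mult_minus matrix_vector_mul_assoc[symmetric]
    matrix_vector_mult_diff_rdistrib mat_smult
  have G: "G *v v = N\<^sup>D *v v - \<mu> *s (N\<^sup>D *v (N *v v))" for v
    by (simp add: G_def lin)
  have cv: "N\<^sup>D *v (N *v v) = N *v (N\<^sup>D *v v)" for v
    by (simp add: matrix_vector_mul_assoc c)
  have dv: "N\<^sup>D *v (N *v (N\<^sup>D *v v)) = N\<^sup>D *v v" for v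
    by (simp add: matrix_vector_mul_assoc matrix_mul_assoc d)
  show ?thesis
  proof
    assume dae: "\<forall>t\<in>{a..b}. w t = - (N *v (w' t - \<mu> *s w t))"
    \<comment> \<open>The component of \<open>w\<close> in the nilpotent part of \<open>N\<close>.\<close>
    define y where "y = (\<lambda>t. w t - (N\<^sup>D ** N) *v w t)"
    define y' where "y' = (\<lambda>t. w' t - (N\<^sup>D ** N) *v w' t)"
    have Ny: "N *v y' t = \<mu> *s (N *v y t) - y t" if "t \<in> {a..b}" for t
    proof -
      have "- w t = N *v w' t - \<mu> *s (N *v w t)"
        using arg_cong[OF bspec[OF dae that], of uminus] by (simp only: lin minus_minus)
      then have Nw: "N *v w' t = \<mu> *s (N *v w t) - w t"
        by (simp add: algebra_simps)
      have "N *v y' t = N *v w' t - N *v (N\<^sup>D *v (N *v w' t))"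
        by (simp add: y'_def lin)
      also have "\<dots> = \<mu> *s (N *v y t) - y t"
        unfolding Nw y_def by (simp add: lin algebra_simps cv[symmetric] vector_sub_rdistrib vec.scale_right_diff_distrib)
      finally show ?thesis .
    qed
    have dy: "((\<lambda>t. matpow N i *v y t) has_vector_derivative matpow N i *v y' t) (at t within {a..b})"
      if "t \<in> {a..b}" for t i
      unfolding y_def y'_def
      by (intro bounded_linear.has_vector_derivative[OF matrix_vector_mul_bounded_linear]
          has_vector_derivative_diff w that)
    \<comment> \<open>Descent from exponent \<open>Suc i\<close> to \<open>i\<close>, using that the derivative of the zero function is zero.\<close>
    have step: "\<forall>t\<in>{a..b}. matpow N i *v y t = 0" if z: "\<forall>t\<in>{a..b}. matpow N (Suc i) *v y t = 0" for i
    proof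
      fix t assume t: "t \<in> {a..b}"
      have "((\<lambda>t. 0) has_vector_derivative matpow N (Suc i) *v y' t) (at t within {a..b})"
        by (rule has_vector_derivative_transform[OF t _ dy[OF t, of "Suc i"]])
           (use z in \<open>simp del: matpow.simps\<close>)
      then have "matpow N (Suc i) *v y' t = 0"
        using vector_derivative_unique_within_closed_interval[OF \<open>a < b\<close>, of t] t has_vector_derivative_const
        by (metis box_real(2))
      then have "matpow N i *v (\<mu> *s (N *v y t) - y t) = 0"
        using Ny[OF t] by (simp add: matpow_Suc_right matrix_vector_mul_assoc[symmetric] del: matpow.simps)
      moreover have "matpow N i *v (N *v y t) = 0"
        using z t by (simp add: matpow_Suc_right matrix_vector_mul_assoc[symmetric] del: matpow.simps)
      ultimately show "matpow N i *v y t = 0" by (simp add: lin)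
    qed
    have "matpow N k *v y t = 0" for t
    proof -
      have "matpow N k ** (N\<^sup>D ** N) = N\<^sup>D ** matpow N (Suc k)"
        by (simp add: matpow_commute c matrix_mul_assoc)
           (metis c matpow_commute matrix_mul_assoc)
      then have "matpow N k ** (N\<^sup>D ** N) = matpow N k" using k by simp
      then show ?thesis by (simp add: y_def lin(1) matrix_vector_mul_assoc)
    qed
    then have "\<forall>t\<in>{a..b}. matpow N 0 *v y t = 0"
      using step by (intro inc_induct[of 0 k "\<lambda>i. \<forall>t\<in>{a..b}. matpow N i *v y t = 0"]) auto
    then have proj: "w t = (N\<^sup>D ** N) *v w t" if "t \<in> {a..b}" for t
      using that by (simp add: y_def)
    moreover have "w' t = - (G *v w t)" if t: "t \<in> {a..b}" for t
    proof -
      have "((\<lambda>t. (N\<^sup>D ** N) *v w t) has_vector_derivative (N\<^sup>D ** N) *v w' t) (at t within {a..b})"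
        by (intro bounded_linear.has_vector_derivative[OF matrix_vector_mul_bounded_linear] w t)
      then have "(w has_vector_derivative (N\<^sup>D ** N) *v w' t) (at t within {a..b})"
        by (rule has_vector_derivative_transform[OF t proj, rotated])
      then have "w' t = (N\<^sup>D ** N) *v w' t"
        using vector_derivative_unique_within_closed_interval[OF \<open>a < b\<close>, of t w] t w[OF t]
        by (metis box_real(2))
      also have "\<dots> = N\<^sup>D *v (N *v (w' t - \<mu> *s w t)) + \<mu> *s (N\<^sup>D *v (N *v w t))"
        by (simp add: lin)
      also have "N *v (w' t - \<mu> *s w t) = - w t"
        using dae t by (metis minus_minus)
      finally show ?thesis by (simp add: G lin)
    qed
    ultimately show "\<forall>t\<in>{a..b}. w t = (N\<^sup>D ** N) *v w t \<and> w' t = - (G *v w t)" by blast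
  next
    assume *: "\<forall>t\<in>{a..b}. w t = (N\<^sup>D ** N) *v w t \<and> w' t = - (G *v w t)"
    show "\<forall>t\<in>{a..b}. w t = - (N *v (w' t - \<mu> *s w t))"
    proof
      fix t assume "t \<in> {a..b}"
      from bspec[OF * this] have p: "N\<^sup>D *v (N *v w t) = w t" and w': "w' t = - (G *v w t)"
        by (simp_all only: matrix_vector_mul_assoc)
      show "w t = - (N *v (w' t - \<mu> *s w t))"
        unfolding w' G p by (simp add: lin cv[symmetric] p)
    qed
  qed
qed

section \<open>Block matrices and Schur complements\<close>

lemma vcat_nth [simp]: "vcat v w $ Inl i = v $ i" "vcat v w $ Inr j = w $ j"
  by (simp_all add: vcat_def)

lemma vcat_eq_iff: "vcat v w = vcat v' w' \<longleftrightarrow> v = v' \<and> w = w'"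
  by (auto simp: vec_eq_iff split_sum_all)

lemma vcat_arith:
  "vcat v w + vcat v' w' = vcat (v + v') (w + w')"
  "vcat v w - vcat v' w' = vcat (v - v') (w - w')"
  "- vcat v w = vcat (- v) (- w)"
  "c *s vcat v w = vcat (c *s v) (c *s w)"
  "vcat 0 0 = 0"
  by (auto simp: vec_eq_iff split_sum_all)

lemma vcat_cases:
  obtains v w where "z = vcat v w"
proof
  show "z = vcat (\<chi> i. z $ Inl i) (\<chi> i. z $ Inr i)"
    by (simp add: vec_eq_iff split_sum_all)
qed

lemma vcat_mult_vector: "vcat A B *v v = vcat (A *v v) (B *v v)"
  by (simp add: vec_eq_iff split_sum_all matrix_vector_mult_def)

lemma hcat_mult_vcat: "hcat A B *v vcat v w = A *v v + B *v w"
  by (simp add: vec_eq_iff matrix_vector_mult_def hcat_def sum.Plus flip: UNIV_Plus_UNIV)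

lemma block_mult_vcat:
  "block A B C D *v vcat v w = vcat (A *v v + B *v w) (C *v v + D *v w)"
  by (simp add: block_def vcat_mult_vector hcat_mult_vcat)

lemmas block_simps =
  block_mult_vcat hcat_mult_vcat vcat_mult_vector vcat_arith vcat_eq_iff mat_smult
  matrix_mult_minus matrix_vector_mult_diff_rdistrib matrix_vector_mult_add_rdistrib

text \<open>
Block elimination: the first equation gives \<open>w = -E (y + b u)\<close>, and substituting this into the
second one leaves the equation \<open>(S - c E b) u = c E y\<close> with the Schur complement as its matrix.
\<close>

lemma schur_complement_solve:
  fixes P E :: "complex^'k^'k" and b :: "complex^'m^'k" and c :: "complex^'k^'m"
  assumes E: "E ** P = mat 1" "P ** E = mat 1"
    and T: "T ** (S - c ** E ** b) = mat 1" "(S - c ** E ** b) ** T = mat 1"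
  shows "P *v w + b *v u = - y \<and> c *v w + S *v u = 0 \<longleftrightarrow>
    w = - ((E + E ** b ** T ** c ** E) *v y) \<and> u = (T ** c ** E) *v y"
proof -
  note lin = matrix_vector_mult_diff_distrib matrix_vector_right_distrib matrix_mult_minus
    matrix_vector_mult_diff_rdistrib matrix_vector_mult_add_rdistrib matrix_vector_mul_assoc[symmetric]
  have Ev: "E *v (P *v v) = v" "P *v (E *v v) = v" for v
    by (simp_all add: matrix_vector_mul_assoc E)
  have Tv: "T *v ((S - c ** E ** b) *v v) = v" "(S - c ** E ** b) *v (T *v v) = v" for v
    by (simp_all only: matrix_vector_mul_assoc T matrix_vector_mul_lid)
  show ?thesis
  proof
    assume *: "P *v w + b *v u = - y \<and> c *v w + S *v u = 0"
    then have "P *v w = - y - b *v u" by (simp add: algebra_simps)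
    then have w: "w = - (E *v y) - E *v (b *v u)"
      using Ev(1)[of w] by (simp add: lin)
    have "(S - c ** E ** b) *v u = c *v (E *v y)"
      using conjunct2[OF *] unfolding w by (simp add: lin algebra_simps)
    then have "u = (T ** c ** E) *v y"
      using Tv(1)[of u] by (simp add: lin)
    with w show "w = - ((E + E ** b ** T ** c ** E) *v y) \<and> u = (T ** c ** E) *v y"
      by (simp add: lin)
  next
    assume "w = - ((E + E ** b ** T ** c ** E) *v y) \<and> u = (T ** c ** E) *v y"
    then have w: "w = - (E *v y) - E *v (b *v u)" and u: "u = T *v (c *v (E *v y))"
      by (simp_all add: lin)
    have "S *v u = c *v (E *v y) + c *v (E *v (b *v u))"
      using Tv(2)[of "c *v (E *v y)"] by (simp add: u[symmetric] lin algebra_simps)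
    then show "P *v w + b *v u = - y \<and> c *v w + S *v u = 0"
      unfolding w by (simp add: lin Ev)
  qed
qed

lemma matrix_inv_mult:
  assumes "invertible (A :: complex^'n^'n)"
  shows "matrix_inv A ** A = mat 1" "A ** matrix_inv A = mat 1"
  using someI_ex[of "\<lambda>A'. A ** A' = mat 1 \<and> A' ** A = mat 1"] assms
  unfolding invertible_def matrix_inv_def by blast+

lemma invertibleI_ker:
  fixes A :: "complex^'n^'n"
  assumes "\<And>v. A *v v = 0 \<Longrightarrow> v = 0"
  shows "invertible A"
  using assms by (auto simp: invertible_left_inverse matrix_left_invertible_ker)

section \<open>Solutions of the optimality system\<close>

theorem proposition4p1:
  fixes K :: "complex set"
    and J R Q :: "complex^'n::finite^'n" and B :: "complex^'m::finite^'n" and S :: "complex^'m^'m"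
    and \<mu> :: complex and t\<^sub>0 t\<^sub>1 :: real
    and E\<^sub>\<mu> N\<^sub>\<mu> :: "complex^('n + 'n)^('n + 'n)"
    and S\<^sub>\<mu> :: "complex^'m^'m" and M\<^sub>\<mu> :: "complex^('n + 'n)^'m"
    and l x :: "real \<Rightarrow> complex^'n" and u :: "real \<Rightarrow> complex^'m"
  assumes "K = \<real> \<or> K = UNIV"
    and "t\<^sub>0 < t\<^sub>1"
    and "(J, R, Q, B) \<in> Sigma_sys K"
    and "S \<in> mats K" and "S\<^sup>H = S" and "pos_semidef K S"
    and "regular_pencil pencil_E (pencil_A J R Q B S)"
    and "\<mu> \<in> K - (spectrum ((J - R) ** Q) \<union> spectrum (- ((J - R) ** Q)\<^sup>H))"
    and "invertible (mat \<mu> ** pencil_E - pencil_A J R Q B S)"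
    and "E\<^sub>\<mu> = matrix_inv (block 0 ((J - R) ** Q - mat \<mu>)
                              (((J - R) ** Q)\<^sup>H + mat \<mu>) (Q ** R ** Q))"
    and "S\<^sub>\<mu> = S - hcat (B\<^sup>H) 0 ** E\<^sub>\<mu> ** vcat B 0"
    and "N\<^sub>\<mu> = (E\<^sub>\<mu> + E\<^sub>\<mu> ** vcat B 0 ** matrix_inv S\<^sub>\<mu> ** hcat (B\<^sup>H) 0 ** E\<^sub>\<mu>)
                 ** block 0 (- mat 1) (mat 1) 0"
    and "M\<^sub>\<mu> = - matrix_inv S\<^sub>\<mu> ** hcat (B\<^sup>H) 0 ** E\<^sub>\<mu> ** block 0 (- mat 1) (mat 1) 0"
    and "C1_fun K t\<^sub>0 t\<^sub>1 (\<lambda>t. vcat (vcat (l t) (x t)) (u t))"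
  shows "dae_solution t\<^sub>0 t\<^sub>1 pencil_E (pencil_A J R Q B S)
             (\<lambda>t. vcat (vcat (l t) (x t)) (u t))
     \<longleftrightarrow>
         vcat (l t\<^sub>0) (x t\<^sub>0) \<in> (\<lambda>v. (N\<^sub>\<mu>\<^sup>D ** N\<^sub>\<mu>) *v v) ` vecs K \<and>
         (\<forall>t\<in>{t\<^sub>0..t\<^sub>1}.
            vcat (l t) (x t) =
              matexp (- ((t - t\<^sub>0) *\<^sub>R (N\<^sub>\<mu>\<^sup>D ** (mat 1 - mat \<mu> ** N\<^sub>\<mu>)))) *v vcat (l t\<^sub>0) (x t\<^sub>0) \<and>
            u t = (M\<^sub>\<mu> ** N\<^sub>\<mu>\<^sup>D) *v vcat (l t) (x t))"
proof -
  define F where "F = (J - R) ** Q"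
  define P where "P = block 0 (F - mat \<mu>) (F\<^sup>H + mat \<mu>) (Q ** R ** Q)"
  define b :: "complex^'m^('n + 'n)" where "b = vcat B 0"
  define c :: "complex^('n + 'n)^'m" where "c = hcat (B\<^sup>H) 0"
  define W :: "complex^('n + 'n)^('n + 'n)" where "W = block 0 (- mat 1) (mat 1) 0"
  define G where "G = N\<^sub>\<mu>\<^sup>D ** (mat 1 - mat \<mu> ** N\<^sub>\<mu>)"
  let ?A = "pencil_A J R Q B S"
  let ?I = "{t\<^sub>0..t\<^sub>1}"
  note S\<^sub>\<mu> = assms(11)[folded b_def c_def]
  note N\<^sub>\<mu> = assms(12)[folded b_def c_def W_def]
  note M\<^sub>\<mu> = assms(13)[folded b_def c_def W_def]
  define w where "w t = vcat (l t) (x t)" for t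

  \<comment> \<open>Subtracting \<open>\<mu>\<close> times the left-hand matrix replaces only the upper left block, which becomes
    the invertible matrix \<open>P\<close>.\<close>
  have shifted: "?A *v vcat v q - \<mu> *s (pencil_E *v vcat v q) = vcat (P *v v + b *v q) (c *v v + S *v q)" for v q
  proof -
    obtain v1 v2 where v: "v = vcat v1 v2" by (rule vcat_cases)
    show ?thesis
      by (simp add: v pencil_A_def pencil_E_def P_def b_def c_def F_def block_simps)
  qed
  have E: "pencil_E *v vcat v q = vcat (- (W *v v)) (0 :: complex^'m)" for v and q :: "complex^'m"
  proof -
    obtain v1 v2 where v: "v = vcat v1 v2" by (rule vcat_cases)
    show ?thesis
      by (simp add: v pencil_E_def W_def block_simps)
  qed

  \<comment> \<open>\<open>P\<close> is block triangular up to exchanging its columns, and its two off-diagonal blocks are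
    injective because \<open>\<mu>\<close> avoids both spectra.\<close>
  have "invertible P"
  proof (rule invertibleI_ker)
    fix v assume z: "P *v v = 0"
    obtain v1 v2 where v: "v = vcat v1 v2" by (rule vcat_cases)
    from z have "vcat ((F - mat \<mu>) *v v2) ((F\<^sup>H + mat \<mu>) *v v1 + (Q ** R ** Q) *v v2) = vcat 0 0"
      by (simp add: v P_def block_mult_vcat vcat_arith)
    then have 1: "(F - mat \<mu>) *v v2 = 0" and 2: "(F\<^sup>H + mat \<mu>) *v v1 + (Q ** R ** Q) *v v2 = 0"
      by (simp_all add: vcat_eq_iff)
    have "F *v v2 = \<mu> *s v2" using 1 by (simp add: matrix_vector_mult_diff_rdistrib mat_smult)
    then have v2: "v2 = 0" using assms(8) by (auto simp: spectrum_def F_def)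
    have "(- F\<^sup>H) *v v1 = \<mu> *s v1"
      using 2 by (simp add: v2 matrix_vector_mult_add_rdistrib mat_smult matrix_mult_minus neg_eq_iff_add_eq_0)
    then have "v1 = 0" using assms(8) by (auto simp: spectrum_def F_def)
    then show "v = 0" by (simp add: v v2 vcat_arith)
  qed
  then have inv: "E\<^sub>\<mu> ** P = mat 1" "P ** E\<^sub>\<mu> = mat 1"
    using matrix_inv_mult assms(10) by (auto simp: P_def F_def)

  \<comment> \<open>A kernel vector of the Schur complement extends to a kernel vector of the shifted pencil.\<close>
  have "invertible S\<^sub>\<mu>"
  proof (rule invertibleI_ker)
    fix q assume q: "S\<^sub>\<mu> *v q = 0"
    define v where "v = - (E\<^sub>\<mu> *v (b *v q))"
    have "P *v v + b *v q = 0"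
      by (simp add: v_def matrix_mult_minus matrix_vector_mul_assoc matrix_mul_assoc inv)
    moreover have "c *v v + S *v q = 0"
      using q by (simp add: v_def S\<^sub>\<mu> matrix_mult_minus matrix_vector_mult_diff_rdistrib
          matrix_vector_mul_assoc matrix_mul_assoc)
    ultimately have "(mat \<mu> ** pencil_E - ?A) *v vcat v q = 0"
      using shifted[of v q]
      by (simp add: matrix_vector_mult_diff_rdistrib matrix_vector_mul_assoc[symmetric] mat_smult vcat_arith)
    then have "vcat v q = vcat 0 0"
      using assms(9) by (auto simp: invertible_left_inverse matrix_left_invertible_ker vcat_arith)
    then show "q = 0" by (simp add: vcat_eq_iff)
  qed
  note invS = matrix_inv_mult[OF this]

  obtain z' where z: "\<And>t. t \<in> ?I \<Longrightarrow> ((\<lambda>t. vcat (w t) (u t)) has_vector_derivative z' t) (at t within ?I)"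
    using assms(14) unfolding C1_fun_def w_def by blast
  have fin: "vcat (l t\<^sub>0) (x t\<^sub>0) \<in> vecs K"
    using assms(2,14) by (auto simp: C1_fun_def vecs_def split_sum_all)
  define w' where "w' t = hcat (mat 1) 0 *v z' t" for t
  define u' where "u' t = hcat 0 (mat 1) *v z' t" for t
  have z': "z' t = vcat (w' t) (u' t)" for t
    by (rule vcat_cases[of "z' t"]) (simp add: w'_def u'_def hcat_mult_vcat)
  have w: "(w has_vector_derivative w' t) (at t within ?I)" if "t \<in> ?I" for t
    using bounded_linear.has_vector_derivative[OF matrix_vector_mul_bounded_linear z[OF that],
        of "hcat (mat 1) 0"]
    by (simp add: w'_def hcat_mult_vcat)
  \<comment> \<open>In terms of \<open>d\<close> the differential-algebraic equation is a linear system at each single time.\<close>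
  define d where "d t = w' t - \<mu> *s w t" for t

  have "dae_solution t\<^sub>0 t\<^sub>1 pencil_E ?A (\<lambda>t. vcat (w t) (u t)) \<longleftrightarrow>
    (\<forall>t\<in>?I. pencil_E *v vcat (w' t) (u' t) = ?A *v vcat (w t) (u t))"
    unfolding dae_solution_def
  proof (intro ball_cong refl)
    fix t assume t: "t \<in> ?I"
    have "((\<lambda>t. pencil_E *v vcat (w t) (u t)) has_vector_derivative pencil_E *v vcat (w' t) (u' t)) (at t within ?I)"
      unfolding z'[symmetric]
      by (rule bounded_linear.has_vector_derivative[OF matrix_vector_mul_bounded_linear z[OF t]])
    then show "((\<lambda>t. pencil_E *v vcat (w t) (u t)) has_vector_derivative ?A *v vcat (w t) (u t)) (at t within ?I) \<longleftrightarrow>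
        pencil_E *v vcat (w' t) (u' t) = ?A *v vcat (w t) (u t)"
      using vector_derivative_unique_within_closed_interval[OF assms(2), of t] t by (auto simp flip: box_real(2))
  qed
  also have "\<dots> \<longleftrightarrow> (\<forall>t\<in>?I. w t = - (N\<^sub>\<mu> *v d t) \<and> u t = - (M\<^sub>\<mu> *v d t))"
  proof (intro ball_cong refl)
    fix t
    have "pencil_E *v vcat (w' t) (u' t) = ?A *v vcat (w t) (u t) \<longleftrightarrow>
        pencil_E *v vcat (w' t) (u' t) - \<mu> *s (pencil_E *v vcat (w t) (u t)) =
        ?A *v vcat (w t) (u t) - \<mu> *s (pencil_E *v vcat (w t) (u t))" by simp
    also have "\<dots> \<longleftrightarrow> vcat (- (W *v d t)) 0 = vcat (P *v w t + b *v u t) (c *v w t + S *v u t)"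
      unfolding shifted unfolding E
      by (simp add: d_def vcat_arith matrix_vector_mult_diff_distrib linear_matrix_vector_smult vec.scale_right_diff_distrib)
    also have "\<dots> \<longleftrightarrow> P *v w t + b *v u t = - (W *v d t) \<and> c *v w t + S *v u t = 0"
      by (auto simp: vcat_eq_iff)
    also have "\<dots> \<longleftrightarrow> w t = - (N\<^sub>\<mu> *v d t) \<and> u t = - (M\<^sub>\<mu> *v d t)"
      unfolding schur_complement_solve[OF inv invS[unfolded S\<^sub>\<mu>]] N\<^sub>\<mu> M\<^sub>\<mu>
      by (simp add: S\<^sub>\<mu> matrix_vector_mul_assoc matrix_mult_minus)
    finally show "pencil_E *v vcat (w' t) (u' t) = ?A *v vcat (w t) (u t) \<longleftrightarrow>
      w t = - (N\<^sub>\<mu> *v d t) \<and> u t = - (M\<^sub>\<mu> *v d t)" .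
  qed
  also have "\<dots> \<longleftrightarrow> (\<forall>t\<in>?I. w t = (N\<^sub>\<mu>\<^sup>D ** N\<^sub>\<mu>) *v w t \<and> w' t = - (G *v w t)) \<and> (\<forall>t\<in>?I. u t = - (M\<^sub>\<mu> *v d t))"
    using shifted_dae_solution_iff[OF assms(2) w, of N\<^sub>\<mu> \<mu>] by (auto simp: d_def G_def)
  also have "\<dots> \<longleftrightarrow> (\<forall>t\<in>?I. w t = (N\<^sub>\<mu>\<^sup>D ** N\<^sub>\<mu>) *v w t \<and> w' t = - (G *v w t)) \<and>
      (\<forall>t\<in>?I. u t = (M\<^sub>\<mu> ** N\<^sub>\<mu>\<^sup>D) *v w t)"
  proof (intro conj_cong ball_cong refl)
    \<comment> \<open>Along solutions \<open>d = -N\<^sub>\<mu>\<^sup>D w\<close>: the two terms with \<open>\<mu>\<close> cancel since \<open>N\<^sub>\<mu>\<^sup>D N\<^sub>\<mu>\<close> fixes \<open>w\<close>.\<close>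
    fix t assume "t \<in> ?I" and *: "\<forall>t\<in>?I. w t = (N\<^sub>\<mu>\<^sup>D ** N\<^sub>\<mu>) *v w t \<and> w' t = - (G *v w t)"
    then have "N\<^sub>\<mu>\<^sup>D *v (N\<^sub>\<mu> *v w t) = w t" "w' t = - (G *v w t)"
      by (auto simp: matrix_vector_mul_assoc)
    then have "d t = - (N\<^sub>\<mu>\<^sup>D *v w t)"
      by (simp add: d_def G_def matrix_vector_mul_assoc[symmetric] matrix_vector_mult_diff_rdistrib mat_smult
          matrix_vector_mult_diff_distrib linear_matrix_vector_smult)
    then show "u t = - (M\<^sub>\<mu> *v d t) \<longleftrightarrow> u t = (M\<^sub>\<mu> ** N\<^sub>\<mu>\<^sup>D) *v w t"
      by (simp add: matrix_mult_minus matrix_vector_mul_assoc)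
  qed
  also have "\<dots> \<longleftrightarrow> (w t\<^sub>0 = (N\<^sub>\<mu>\<^sup>D ** N\<^sub>\<mu>) *v w t\<^sub>0 \<and>
      (\<forall>t\<in>?I. w t = matexp (- ((t - t\<^sub>0) *\<^sub>R G)) *v w t\<^sub>0)) \<and> (\<forall>t\<in>?I. u t = (M\<^sub>\<mu> ** N\<^sub>\<mu>\<^sup>D) *v w t)"
  proof -
    have "(N\<^sub>\<mu>\<^sup>D ** N\<^sub>\<mu>) ** G = G"
      unfolding G_def matrix_mul_assoc drazin_inverse_sandwich ..
    from projected_ode_solution_iff[OF assms(2) w this] show ?thesis by simp
  qed
  also have "w t\<^sub>0 = (N\<^sub>\<mu>\<^sup>D ** N\<^sub>\<mu>) *v w t\<^sub>0 \<longleftrightarrow> w t\<^sub>0 \<in> (\<lambda>v. (N\<^sub>\<mu>\<^sup>D ** N\<^sub>\<mu>) *v v) ` vecs K"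
  proof
    \<comment> \<open>The initial value is its own preimage under the projection, which puts the preimage in
      \<open>vecs K\<close>.\<close>
    assume "w t\<^sub>0 = (N\<^sub>\<mu>\<^sup>D ** N\<^sub>\<mu>) *v w t\<^sub>0"
    then show "w t\<^sub>0 \<in> (\<lambda>v. (N\<^sub>\<mu>\<^sup>D ** N\<^sub>\<mu>) *v v) ` vecs K"
      using fin unfolding w_def by (rule image_eqI)
  next
    assume "w t\<^sub>0 \<in> (\<lambda>v. (N\<^sub>\<mu>\<^sup>D ** N\<^sub>\<mu>) *v v) ` vecs K"
    moreover have "(N\<^sub>\<mu>\<^sup>D ** N\<^sub>\<mu>) ** (N\<^sub>\<mu>\<^sup>D ** N\<^sub>\<mu>) = N\<^sub>\<mu>\<^sup>D ** N\<^sub>\<mu>"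
      unfolding matrix_mul_assoc drazin_inverse_sandwich ..
    ultimately show "w t\<^sub>0 = (N\<^sub>\<mu>\<^sup>D ** N\<^sub>\<mu>) *v w t\<^sub>0"
      by (auto simp: matrix_vector_mul_assoc)
  qed
  finally show ?thesis unfolding w_def G_def by auto
qed

end
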